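(* For complex $\alpha,\beta,x,z$, $$\sum_{n=0}^{\infty}\frac{\Gamma(n\beta+1)\,\bigl(x(x+1)^{-\beta}\bigr)^n\;{}_2F_1(-n,-\alpha;\,n(\beta-1)+1;\,z)}{n!\,\Gamma(\beta n-n+1)}=\frac{(x+1)(xz+1)^{\alpha}}{-\beta x+x+1}.$$
   Context: $\Gamma$ is the Euler gamma function and ${}_2F_1(a,b;c;z)=\sum_{k\ge0}\frac{(a)_k(b)_k}{(c)_k\,k!}z^k$ is the Gauss hypergeometric function, with $(a)_k=a(a+1)\cdots(a+k-1)$.
   Formalization: Not true for all x: x is limited to the component of 0 where x(x+1)^(-β) is strictly inside the disc of convergence, the principal powers are analytic and 1+x-βx≠0 (for β=2, α=0, x=2 the sides are 3 and -3); terms at Gamma/2F1 poles are read as limits in β. *)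

theory Defs
  imports "HOL-Complex_Analysis.Complex_Analysis"
begin

definition hyp2F1 :: "complex \<Rightarrow> complex \<Rightarrow> complex \<Rightarrow> complex \<Rightarrow> complex" where
  "hyp2F1 a b c z =
     (\<Sum>k. pochhammer a k * pochhammer b k / (pochhammer c k * fact k) * z ^ k)"

definition raw_coeff :: "complex \<Rightarrow> complex \<Rightarrow> complex \<Rightarrow> nat \<Rightarrow> complex" where
  "raw_coeff \<alpha> \<beta> z n =
     Gamma (of_nat n * \<beta> + 1) *
       hyp2F1 (- of_nat n) (- \<alpha>) (of_nat n * (\<beta> - 1) + 1) z /
     (fact n * Gamma (\<beta> * of_nat n - of_nat n + 1))"

text \<open>
  If \<open>n (\<beta> - 1) + 1\<close> is a nonpositive integer (possible only for rational \<open>\<beta> < 1\<close>), the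
  denominator parameter of the hypergeometric function is one of its poles and the Gamma function
  in the denominator has a pole as well. The quotient then has a removable singularity in \<open>\<beta>\<close> and
  is read as its limit. For all other \<open>\<beta>\<close> everything in \<open>raw_coeff\<close> is defined: a pole of
  \<open>Gamma (n \<beta> + 1)\<close> would make \<open>n (\<beta> - 1) + 1\<close> a nonpositive integer too.
\<close>
definition coeff_at :: "complex \<Rightarrow> complex \<Rightarrow> complex \<Rightarrow> nat \<Rightarrow> complex" where
  "coeff_at \<alpha> \<beta> z n =
     (if of_nat n * (\<beta> - 1) + 1 \<in> \<int>\<^sub>\<le>\<^sub>0
      then Lim (at \<beta>) (\<lambda>b. raw_coeff \<alpha> b z n)
      else raw_coeff \<alpha> \<beta> z n)"

text \<open>
  The left-hand side is a power series in \<open>x (x + 1) powr (- \<beta>)\<close>, which is not an injective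
  function of \<open>x\<close>. Convergence alone is therefore not enough for the identity: for \<open>\<beta> = 2\<close>,
  \<open>\<alpha> = 0\<close> the left-hand side is invariant under \<open>x \<mapsto> 1 / x\<close> while the right-hand side changes
  sign. The identity holds on the component of \<open>0\<close> of the set of all \<open>x\<close> at which the series
  converges (in the interior of its disc of convergence), the principal powers are analytic and
  the denominator of the right-hand side does not vanish.
\<close>
definition validity_region :: "complex \<Rightarrow> complex \<Rightarrow> complex \<Rightarrow> complex set" where
  "validity_region \<alpha> \<beta> z =
     connected_component_set
       {x. ereal (norm (x * (x + 1) powr (- \<beta>))) < conv_radius (coeff_at \<alpha> \<beta> z) \<and>
           (\<lambda>t. (t + 1) powr (- \<beta>)) analytic_on {x} \<and>
           (\<lambda>t. (t * z + 1) powr \<alpha>) analytic_on {x} \<and>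
           - \<beta> * x + x + 1 \<noteq> 0} 0"

end

theory Submission
  imports Defs
begin

text \<open>
  The coefficient of the \<open>n\<close>-th power on the left is the \<open>n\<close>-th Taylor coefficient at \<open>0\<close> of
  \<open>(1 + z t)\<^sup>\<alpha> \<phi>(t)\<^sup>n\<close> with \<open>\<phi>(t) = (1 + t)\<^sup>\<beta>\<close>. For small \<open>x\<close>, the number \<open>w = x / \<phi>(x)\<close> is small and
  \<open>x\<close> is the solution of \<open>x = w \<phi>(x)\<close>, so the second form of the Lagrange-Buermann theorem sums the
  series to \<open>(1 + z x)\<^sup>\<alpha> / (1 - w \<phi>'(x))\<close>, the right-hand side. The identity theorem extends
  this to the whole component of \<open>0\<close>.
\<close>

section \<open>Lagrange-Buermann summation by Cauchy integrals\<close>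

text \<open>
  Write the Taylor coefficients as Cauchy integrals of \<open>F \<phi>\<^sup>n / t\<^sup>n\<^sup>+\<^sup>1\<close> over the circle of radius \<open>\<rho>\<close>.
  For small \<open>w\<close> the map \<open>w \<phi>\<close> is a contraction, so \<open>x\<close> is the only zero of \<open>t - w \<phi>(t)\<close> in the disc,
  and the geometric series sums the integrands to \<open>F(t) / (t - w \<phi>(t))\<close>.
\<close>
lemma lagrange_buermann:
  fixes F \<phi> :: "complex \<Rightarrow> complex"
  assumes S: "open S" "cball 0 \<rho> \<subseteq> S" and \<rho>: "\<rho> > 0"
    and F: "F holomorphic_on S" and \<phi>: "\<phi> holomorphic_on S"
  shows "\<exists>\<epsilon>>0. \<forall>w x. norm w < \<epsilon> \<longrightarrow> norm x < \<rho> \<longrightarrow> x = w * \<phi> x \<longrightarrow>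
           (\<lambda>n. (deriv ^^ n) (\<lambda>t. F t * \<phi> t ^ n) 0 / fact n * w ^ n) sums
             (F x / (1 - w * deriv \<phi> x))"
proof -
  have bounded: "\<exists>B>0. \<forall>t\<in>cball 0 \<rho>. norm (f t) \<le> B" if "f holomorphic_on S" for f
  proof -
    have "compact (f ` cball 0 \<rho>)"
      using that S(2)
      by (intro compact_continuous_image holomorphic_on_imp_continuous_on)
         (auto intro: holomorphic_on_subset)
    then show ?thesis
      using compact_imp_bounded bounded_pos by (metis imageI)
  qed
  obtain M where M: "M > 0" "\<And>t. norm t \<le> \<rho> \<Longrightarrow> norm (\<phi> t) \<le> M"
    using bounded[OF \<phi>] by auto
  obtain L where L: "L > 0" "\<And>t. norm t \<le> \<rho> \<Longrightarrow> norm (deriv \<phi> t) \<le> L"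
    using bounded[OF holomorphic_deriv[OF \<phi> S(1)]] by auto
  obtain K where K: "K > 0" "\<And>t. norm t \<le> \<rho> \<Longrightarrow> norm (F t) \<le> K"
    using bounded[OF F] by auto
  \<comment> \<open>The first bound gives |w \<phi>(t)| \<le> \<rho>/2 on the disc, so the geometric
    ratio w \<phi>(t)/t has modulus at most 1/2 on the circle. The second makes w \<phi> Lipschitz
    with constant 1/2, so that it has at most one fixed point in the disc.\<close>
  define \<epsilon> where "\<epsilon> = min (\<rho> / (2 * M)) (1 / (2 * L))"
  have \<epsilon>: "\<epsilon> > 0" using \<rho> M(1) L(1) by (simp add: \<epsilon>_def)
  have lip: "norm (\<phi> s - \<phi> t) \<le> L * norm (s - t)" if "norm s \<le> \<rho>" "norm t \<le> \<rho>" for s t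
  proof (rule field_differentiable_bound[of "cball 0 \<rho>" \<phi> "deriv \<phi>"])
    show "(\<phi> has_field_derivative deriv \<phi> u) (at u within cball 0 \<rho>)" if "u \<in> cball 0 \<rho>" for u
      using that S \<phi> by (auto intro: holomorphic_derivI)
  qed (use that L in auto)
  have "(\<lambda>n. (deriv ^^ n) (\<lambda>t. F t * \<phi> t ^ n) 0 / fact n * w ^ n) sums
          (F x / (1 - w * deriv \<phi> x))"
    if w: "norm w < \<epsilon>" and x: "norm x < \<rho>" and fix_x: "x = w * \<phi> x" for w x
  proof -
    have wM: "norm w * M \<le> \<rho> / 2" and wL: "norm w * L \<le> 1 / 2"
      using w M(1) L(1) by (auto simp: \<epsilon>_def field_simps)
    define P where "P = (\<lambda>t. t - w * \<phi> t)"
    \<comment> \<open>\<open>h\<close> is P with its simple zero at x divided out: P(t) = (t - x)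
      h(t), with the removable singularity filled by P'(x). As \<open>h\<close> has no zero in the
      closed disc, Cauchy's formula for F/h at x evaluates the integral of F/P.\<close>
    define h where "h = (\<lambda>t. if t = x then deriv P x else (P t - P x) / (t - x))"
    have Px: "P x = 0" using fix_x by (simp add: P_def)
    have xS: "x \<in> S" using x S(2) by auto
    have dP: "deriv P x = 1 - w * deriv \<phi> x"
      unfolding P_def
      by (rule DERIV_imp_deriv) (auto intro!: derivative_eq_intros holomorphic_derivI[OF \<phi> S(1) xS])
    have dP_nz: "deriv P x \<noteq> 0"
    proof
      assume "deriv P x = 0"
      then have "norm (w * deriv \<phi> x) = 1" using dP by (metis eq_iff_diff_eq_0 norm_one)
      moreover have "norm (w * deriv \<phi> x) \<le> norm w * L"
        using L(2)[of x] x by (simp add: norm_mult mult_left_mono)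
      ultimately show False using wL by simp
    qed
    have P_nz: "P t \<noteq> 0" if t: "norm t \<le> \<rho>" "t \<noteq> x" for t
    proof
      assume "P t = 0"
      then have "t - x = w * (\<phi> t - \<phi> x)" using fix_x by (simp add: P_def algebra_simps)
      then have "norm (t - x) \<le> norm w * (L * norm (t - x))"
        using lip[of t x] t(1) x by (metis less_imp_le mult_left_mono norm_ge_zero norm_mult)
      also have "\<dots> \<le> 1 / 2 * norm (t - x)"
        using mult_right_mono[OF wL, of "norm (t - x)"] by (simp add: mult.assoc)
      finally show False using t(2) by simp
    qed
    have h_nz: "h t \<noteq> 0" if "t \<in> cball 0 \<rho>" for t
      using that dP_nz P_nz[of t] Px by (auto simp: h_def)
    have "P holomorphic_on S" unfolding P_def by (intro holomorphic_intros \<phi>)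
    then have "h holomorphic_on S"
      unfolding h_def by (rule pole_lemma) (simp add: S(1) interior_open xS)
    then have "(\<lambda>t. F t / h t) holomorphic_on cball 0 \<rho>"
      using F S(2) h_nz by (intro holomorphic_on_divide) (auto intro: holomorphic_on_subset)
    then have "((\<lambda>t. F t / h t / (t - x)) has_contour_integral 2 * of_real pi * \<i> * (F x / h x))
        (circlepath 0 \<rho>)"
      using x by (intro Cauchy_integral_circlepath_simple) auto
    then have "((\<lambda>t. F t / h t / (t - x)) has_contour_integral 2 * of_real pi * \<i> * (F x / deriv P x))
        (circlepath 0 \<rho>)"
      by (simp add: h_def)
    then have total: "((\<lambda>t. F t / P t) has_contour_integral 2 * of_real pi * \<i> * (F x / deriv P x))
        (circlepath 0 \<rho>)"
    proof (rule has_contour_integral_eq)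
      show "F t / h t / (t - x) = F t / P t" if "t \<in> path_image (circlepath 0 \<rho>)" for t
        using that x \<rho> by (auto simp: h_def Px)
    qed
    define c where "c = (\<lambda>n. (deriv ^^ n) (\<lambda>t. F t * \<phi> t ^ n) 0 / fact n * w ^ n)"
    have part: "((\<lambda>t. F t * \<phi> t ^ n / t ^ Suc n * w ^ n) has_contour_integral
        2 * of_real pi * \<i> * c n) (circlepath 0 \<rho>)" for n
    proof -
      have hol: "(\<lambda>t. F t * \<phi> t ^ n) holomorphic_on S" by (intro holomorphic_intros F \<phi>)
      have "((\<lambda>t. F t * \<phi> t ^ n / (t - 0) ^ Suc n) has_contour_integral
        2 * pi * \<i> / fact n * (deriv ^^ n) (\<lambda>t. F t * \<phi> t ^ n) 0) (circlepath 0 \<rho>)"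
        using S(2) \<rho> ball_subset_cball
        by (intro Cauchy_has_contour_integral_higher_derivative_circlepath
              holomorphic_on_imp_continuous_on holomorphic_on_subset[OF hol]) auto
      from has_contour_integral_rmul[OF this, of "w ^ n"] show ?thesis
        by (simp add: c_def mult_ac)
    qed
    \<comment> \<open>The remainder after N terms. The finite geometric sum turns it into a single
      contour integral carrying the factor (w \<phi>(t)/t)^N, which is then estimated
      directly.\<close>
    define d where "d = (\<lambda>N. F x / deriv P x - (\<Sum>n<N. c n))"
    have rest: "((\<lambda>t. F t / P t * (w * \<phi> t / t) ^ N) has_contour_integral
        2 * of_real pi * \<i> * d N) (circlepath 0 \<rho>)" for N
    proof -
      have "((\<lambda>t. F t / P t - (\<Sum>n<N. F t * \<phi> t ^ n / t ^ Suc n * w ^ n)) has_contour_integral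
          2 * of_real pi * \<i> * d N) (circlepath 0 \<rho>)"
        using has_contour_integral_diff[OF total has_contour_integral_sum[OF _ part, of "{..<N}"]]
        by (simp add: d_def right_diff_distrib sum_distrib_left)
      then show ?thesis
      proof (rule has_contour_integral_eq)
        fix t assume "t \<in> path_image (circlepath 0 \<rho>)"
        then have t: "norm t = \<rho>" using \<rho> by auto
        then have "P t \<noteq> 0" "t \<noteq> 0" using P_nz[of t] x \<rho> by auto
        define q where "q = w * \<phi> t / t"
        have P: "P t = t * (1 - q)" using \<open>t \<noteq> 0\<close> by (simp add: P_def q_def field_simps)
        then have q: "q \<noteq> 1" using \<open>P t \<noteq> 0\<close> by auto
        have "(\<Sum>n<N. F t * \<phi> t ^ n / t ^ Suc n * w ^ n) = F t / t * (\<Sum>n<N. q ^ n)"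
          by (simp add: sum_distrib_left q_def power_divide power_mult_distrib mult_ac)
        also have "\<dots> = F t / P t * (1 - q ^ N)"
          using q by (simp add: P sum_gp_strict)
        finally show "F t / P t - (\<Sum>n<N. F t * \<phi> t ^ n / t ^ Suc n * w ^ n) =
            F t / P t * (w * \<phi> t / t) ^ N"
          by (simp add: q_def right_diff_distrib)
      qed
    qed
    have bound: "norm (d N) \<le> 2 * K * (1 / 2) ^ N" for N
    proof -
      \<comment> \<open>On the circle |F| \<le> K, |P| \<ge> \<rho>/2 and the ratio is at most 1/2
        in modulus. The last factor is the length of the circle.\<close>
      have "norm (2 * of_real pi * \<i> * d N) \<le> (K / (\<rho> / 2) * (1 / 2) ^ N) * (2 * pi * \<rho>)"
      proof (rule has_contour_integral_bound_circlepath[OF rest])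
        fix t :: complex assume "norm (t - 0) = \<rho>"
        then have t: "norm t = \<rho>" by simp
        have wphi: "norm (w * \<phi> t) \<le> \<rho> / 2"
          using M(2)[of t] t wM by (smt (verit) mult_left_mono norm_ge_zero norm_mult)
        have "norm (P t) \<ge> \<rho> / 2"
          using norm_triangle_ineq2[of t "w * \<phi> t"] wphi t by (simp add: P_def)
        moreover have "norm (w * \<phi> t / t) \<le> 1 / 2"
          using wphi t \<rho> by (simp add: norm_divide field_simps)
        ultimately show "norm (F t / P t * (w * \<phi> t / t) ^ N) \<le> K / (\<rho> / 2) * (1 / 2) ^ N"
          unfolding norm_mult norm_divide[of "F t"] norm_power
          using K t \<rho> by (intro mult_mono frac_le power_mono) auto
      qed (use K \<rho> in auto)
      then show ?thesis using \<rho> by (simp add: norm_mult field_simps)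
    qed
    have "d \<longlonglongrightarrow> 0"
    proof (rule Lim_null_comparison)
      show "\<forall>\<^sub>F N in sequentially. norm (d N) \<le> 2 * K * (1 / 2) ^ N" using bound by simp
      show "(\<lambda>N. 2 * K * (1 / 2) ^ N) \<longlonglongrightarrow> 0" by (auto intro!: tendsto_mult_right_zero LIMSEQ_power_zero)
    qed
    then have "(\<lambda>N. F x / deriv P x - d N) \<longlonglongrightarrow> F x / deriv P x - 0"
      by (intro tendsto_intros)
    then show ?thesis by (simp add: sums_def d_def c_def dP)
  qed
  then show ?thesis using \<epsilon> by blast
qed

section \<open>The coefficients as Taylor coefficients\<close>

text \<open>This is the Cauchy product coefficient of t^n in (1 + z t)^\<alpha> (1 + t)^(n \<beta>).
  It is polynomial in \<beta>, so it has no exceptional parameters.\<close>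

definition conv_coeff :: "complex \<Rightarrow> complex \<Rightarrow> complex \<Rightarrow> nat \<Rightarrow> complex" where
  "conv_coeff \<alpha> \<beta> z n = (\<Sum>k\<le>n. z ^ k * (\<alpha> gchoose k) * (of_nat n * \<beta> gchoose (n - k)))"

text \<open>With c = n (\<beta> - 1) + 1 the Gamma quotient is the rising factorial (c)_n, and the
  parameter -n ends the hypergeometric series at k = n. Splitting (c)_n = (c)_k (c + k)_(n-k)
  cancels the denominator (c)_k, and what remains is a product of two binomial coefficients.\<close>

lemma raw_coeff_eq_conv_coeff:
  assumes c: "of_nat n * (\<beta> - 1) + 1 \<notin> \<int>\<^sub>\<le>\<^sub>0"
  shows "raw_coeff \<alpha> \<beta> z n = conv_coeff \<alpha> \<beta> z n"
proof -
  define c where "c = of_nat n * (\<beta> - 1) + 1"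
  have c': "c \<notin> \<int>\<^sub>\<le>\<^sub>0" using c by (simp add: c_def)
  have cn: "of_nat n * \<beta> + 1 = c + of_nat n" "\<beta> * of_nat n - of_nat n + 1 = c"
    by (auto simp: c_def algebra_simps)
  have poch_nz: "pochhammer c k \<noteq> 0" for k
    using c' by (auto simp: pochhammer_eq_0_iff)
  have hyp: "hyp2F1 (- of_nat n) (- \<alpha>) c z =
     (\<Sum>k\<le>n. pochhammer (- of_nat n) k * pochhammer (- \<alpha>) k / (pochhammer c k * fact k) * z ^ k)"
    unfolding hyp2F1_def by (rule suminf_finite) (auto simp: pochhammer_of_nat_eq_0_iff)
  have term_eq: "pochhammer c n / fact n *
      (pochhammer (- of_nat n) k * pochhammer (- \<alpha>) k / (pochhammer c k * fact k) * z ^ k) =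
      z ^ k * (\<alpha> gchoose k) * (of_nat n * \<beta> gchoose (n - k))" if k: "k \<le> n" for k
  proof -
    have 1: "pochhammer (- of_nat n) k = (- 1) ^ k * (fact n / fact (n - k) :: complex)"
      using gbinomial_pochhammer[of "of_nat n :: complex" k] k
      by (simp add: binomial_gbinomial[symmetric] binomial_fact field_simps
            flip: power_mult_distrib)
    have 2: "pochhammer (- \<alpha>) k = (- 1) ^ k * fact k * (\<alpha> gchoose k)"
      by (simp add: gbinomial_pochhammer flip: power_mult_distrib)
    \<comment> \<open>The lowest factor of this binomial coefficient is n \<beta> - (n - k) + 1 = c
      + k.\<close>
    have 3: "of_nat n * \<beta> gchoose (n - k) = pochhammer (c + of_nat k) (n - k) / fact (n - k)"
      using k by (simp add: gbinomial_pochhammer' c_def of_nat_diff algebra_simps)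
    have 4: "pochhammer c n = pochhammer c k * pochhammer (c + of_nat k) (n - k)"
      using k by (rule pochhammer_product)
    show ?thesis unfolding 1 2 3 4
      using poch_nz[of k] by (simp add: field_simps flip: power_mult_distrib)
  qed
  have "raw_coeff \<alpha> \<beta> z n = pochhammer c n / fact n * hyp2F1 (- of_nat n) (- \<alpha>) c z"
    unfolding raw_coeff_def cn pochhammer_Gamma[OF c'] by (simp add: c_def)
  also have "\<dots> = conv_coeff \<alpha> \<beta> z n"
    unfolding hyp conv_coeff_def sum_distrib_left using term_eq by (intro sum.cong) auto
  finally show ?thesis .
qed

text \<open>Exceptional values of \<beta> are isolated for fixed n, so around one of them both
  expressions agree on a punctured neighbourhood. The limit is then read off by continuity of the
  polynomial \<open>conv_coeff\<close> in \<beta>.\<close>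

lemma coeff_at_eq_conv_coeff: "coeff_at \<alpha> \<beta> z n = conv_coeff \<alpha> \<beta> z n"
proof (cases "of_nat n * (\<beta> - 1) + 1 \<in> \<int>\<^sub>\<le>\<^sub>0")
  case True
  then have n: "n > 0" by (cases n) auto
  \<comment> \<open>Two exceptional parameters differ by an integer multiple of 1/n, which fixes the
    radius of the punctured disc.\<close>
  have "raw_coeff \<alpha> b z n = conv_coeff \<alpha> b z n" if b: "b \<noteq> \<beta>" "dist b \<beta> < 1 / real n" for b
  proof (rule raw_coeff_eq_conv_coeff, rule notI)
    assume "of_nat n * (b - 1) + 1 \<in> \<int>\<^sub>\<le>\<^sub>0"
    then have "(of_nat n * (b - 1) + 1) - (of_nat n * (\<beta> - 1) + 1) \<in> \<int>"
      using True by (intro Ints_diff) (auto dest: nonpos_Ints_Int)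
    then have "of_nat n * (b - \<beta>) \<in> \<int>" by (simp add: algebra_simps)
    then obtain m where m: "of_nat n * (b - \<beta>) = of_int m" by (elim Ints_cases)
    have "norm (of_nat n * (b - \<beta>)) < 1"
      using b n unfolding norm_mult by (simp add: dist_norm pos_less_divide_eq mult.commute)
    then have "m = 0" unfolding m norm_of_int by linarith
    then show False using m b n by simp
  qed
  then have "\<forall>\<^sub>F b in at \<beta>. conv_coeff \<alpha> b z n = raw_coeff \<alpha> b z n"
    unfolding eventually_at using n by (intro exI[of _ "1 / real n"]) auto
  moreover have "((\<lambda>b. conv_coeff \<alpha> b z n) \<longlongrightarrow> conv_coeff \<alpha> \<beta> z n) (at \<beta>)"
    unfolding conv_coeff_def gbinomial_prod_rev by (intro tendsto_intros) auto
  ultimately have "((\<lambda>b. raw_coeff \<alpha> b z n) \<longlongrightarrow> conv_coeff \<alpha> \<beta> z n) (at \<beta>)"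
    by (rule Lim_transform_eventually[rotated])
  then show ?thesis using True by (simp add: coeff_at_def tendsto_Lim)
qed (simp add: coeff_at_def raw_coeff_eq_conv_coeff)

text \<open>Both factors have binomial series at 0, and the n-th power of the series for exponent
  \<beta> is the one for n \<beta>. This puts the coefficients in the form required by
  \<open>lagrange_buermann\<close>.\<close>

lemma conv_coeff_eq_deriv:
  "conv_coeff \<alpha> \<beta> z n =
     (deriv ^^ n) (\<lambda>t. (1 + z * t) powr \<alpha> * ((1 + t) powr \<beta>) ^ n) 0 / fact n"
proof -
  have "((\<lambda>t. (1 + t) powr \<alpha>) \<circ> (\<lambda>t. z * t)) has_fps_expansion
      (fps_binomial \<alpha> oo (fps_const z * fps_X))"
    by (intro has_fps_expansion_compose fps_expansion_intros) auto
  then have "(\<lambda>t. (1 + z * t) powr \<alpha> * ((1 + t) powr \<beta>) ^ n) has_fps_expansion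
      (fps_binomial \<alpha> oo (fps_const z * fps_X)) * fps_binomial \<beta> ^ n"
    by (intro fps_expansion_intros) (simp add: o_def)
  from fps_nth_fps_expansion[OF this, of n] show ?thesis
    by (simp add: conv_coeff_def fps_mult_nth atLeast0AtMost fps_binomial_power)
qed


section \<open>The identity near the origin\<close>

lemma eventually_conv_coeff_sums:
  "\<forall>\<^sub>F x in nhds 0. (\<lambda>n. conv_coeff \<alpha> \<beta> z n * (x * (x + 1) powr (- \<beta>)) ^ n) sums
     ((x + 1) * (x * z + 1) powr \<alpha> / (- \<beta> * x + x + 1))"
proof -
  \<comment> \<open>On the disc of radius 2 \<rho> = 1/(1 + |z|) both |t| and |z t| stay below 1, so
    1 + t and 1 + z t avoid the branch cut.\<close>
  define \<rho> where "\<rho> = 1 / (2 * (1 + norm z))"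
  have \<rho>: "\<rho> > 0" "\<rho> \<le> 1 / 2" "norm z * \<rho> \<le> 1 / 2"
    using norm_ge_zero[of z] by (auto simp: \<rho>_def field_simps add_pos_nonneg)
  define S where "S = ball (0::complex) (2 * \<rho>)"
  have slit: "1 + u \<notin> \<real>\<^sub>\<le>\<^sub>0" if "norm u < 1" for u :: complex
    using that abs_Re_le_cmod[of u] by (auto simp: complex_nonpos_Reals_iff)
  have slit_S: "1 + t \<notin> \<real>\<^sub>\<le>\<^sub>0" "1 + z * t \<notin> \<real>\<^sub>\<le>\<^sub>0" if "t \<in> S" for t
  proof -
    have t: "norm t < 2 * \<rho>" using that by (simp add: S_def)
    have "norm (z * t) < 1"
    proof (cases "z = 0")
      case False
      then have "norm z * norm t < norm z * (2 * \<rho>)" using t by simp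
      then show ?thesis using \<rho> by (simp add: norm_mult)
    qed simp
    then show "1 + z * t \<notin> \<real>\<^sub>\<le>\<^sub>0" by (rule slit)
    show "1 + t \<notin> \<real>\<^sub>\<le>\<^sub>0" using t \<rho> by (intro slit) auto
  qed
  have "cball 0 \<rho> \<subseteq> S" using \<rho> by (auto simp: S_def)
  moreover have "(\<lambda>t. (1 + z * t) powr \<alpha>) holomorphic_on S" "(\<lambda>t. (1 + t) powr \<beta>) holomorphic_on S"
    using slit_S by (auto intro!: holomorphic_intros)
  ultimately obtain \<epsilon> where \<epsilon>: "\<epsilon> > 0" and
    sums: "\<And>w x. \<lbrakk>norm w < \<epsilon>; norm x < \<rho>; x = w * (1 + x) powr \<beta>\<rbrakk> \<Longrightarrow>
       (\<lambda>n. conv_coeff \<alpha> \<beta> z n * w ^ n) sums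
         ((1 + z * x) powr \<alpha> / (1 - w * deriv (\<lambda>t. (1 + t) powr \<beta>) x))"
    using lagrange_buermann[of S \<rho> "\<lambda>t. (1 + z * t) powr \<alpha>" "\<lambda>t. (1 + t) powr \<beta>"] \<rho>(1)
    unfolding conv_coeff_eq_deriv by (auto simp: S_def)
  have "((\<lambda>x::complex. x * (x + 1) powr (- \<beta>)) \<longlongrightarrow> 0 * (0 + 1) powr (- \<beta>)) (nhds 0)"
    by (intro tendsto_intros) (auto intro: filterlim_ident)
  then have "\<forall>\<^sub>F x in nhds 0. norm (x * (x + 1) powr (- \<beta>)) < \<epsilon>"
    using \<epsilon> by (auto simp: tendsto_iff)
  moreover have "\<forall>\<^sub>F x::complex in nhds 0. x \<in> ball 0 \<rho>"
    using \<rho> by (intro eventually_nhds_in_open) auto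
  ultimately show ?thesis
  proof eventually_elim
    case (elim x)
    define w where "w = x * (x + 1) powr (- \<beta>)"
    have x: "norm x < \<rho>" using elim by simp
    have xS: "x \<in> S" using x \<rho> by (simp add: S_def)
    have x1: "1 + x \<noteq> 0" using slit_S(1)[OF xS] by auto
    have w\<phi>: "w * (1 + x) powr \<beta> = x"
      using x1 by (simp add: w_def add.commute powr_minus field_simps)
    have "deriv (\<lambda>t. (1 + t) powr \<beta>) x = \<beta> * (1 + x) powr (\<beta> - 1)"
      by (rule DERIV_imp_deriv) (use slit_S(1)[OF xS] in \<open>auto intro!: derivative_eq_intros\<close>)
    \<comment> \<open>Since w \<phi>(x) = x, this equals \<beta> x/(1 + x), which produces the
      denominator 1 + x - \<beta> x and the factor x + 1 of the claimed sum.\<close>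
    then have "w * deriv (\<lambda>t. (1 + t) powr \<beta>) x = \<beta> * (w * (1 + x) powr \<beta>) / (1 + x)"
      using x1 by (simp add: powr_diff)
    then have "1 - w * deriv (\<lambda>t. (1 + t) powr \<beta>) x = (- \<beta> * x + x + 1) / (x + 1)"
      using x1 by (simp add: w\<phi> field_simps)
    then show ?case
      using sums[of w x] elim w\<phi> x unfolding w_def by (simp add: add.commute mult.commute)
  qed
qed

text \<open>Convergence at one nonzero argument of the power series suffices. A small positive real
  x supplies it, because x and x + 1 are both nonzero.\<close>

lemma conv_radius_conv_coeff_pos: "conv_radius (conv_coeff \<alpha> \<beta> z) > 0"
proof -
  obtain e where e: "e > 0" and sums: "\<And>x. dist x 0 < e \<Longrightarrow>
      summable (\<lambda>n. conv_coeff \<alpha> \<beta> z n * (x * (x + 1) powr (- \<beta>)) ^ n)"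
    using eventually_conv_coeff_sums[of \<alpha> \<beta> z] unfolding eventually_nhds_metric
    by (auto simp: sums_iff)
  define r where "r = e / 2"
  have r: "r > 0" "r < e" using e by (auto simp: r_def)
  define x where "x = complex_of_real r"
  have "x + 1 \<noteq> 0" 
    using r unfolding x_def by (metis of_real_eq_0_iff of_real_1 of_real_add add_pos_pos less_irrefl zero_less_one)
  then have "norm (x * (x + 1) powr (- \<beta>)) > 0" using r by (simp add: x_def)
  moreover have "norm (x * (x + 1) powr (- \<beta>)) \<le> conv_radius (conv_coeff \<alpha> \<beta> z)"
    using r by (intro conv_radius_geI sums) (simp add: x_def)
  ultimately show ?thesis by (metis ereal_less(2) less_le_trans)
qed

section \<open>Analytic continuation to the component of 0\<close>

theorem proposition3p1:
  fixes \<alpha> \<beta> z :: complex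
  shows "(\<exists>r>0. ball 0 r \<subseteq> validity_region \<alpha> \<beta> z) \<and>
         (\<forall>x\<in>validity_region \<alpha> \<beta> z.
            (\<lambda>n. coeff_at \<alpha> \<beta> z n * (x * (x + 1) powr (- \<beta>)) ^ n) sums
              ((x + 1) * (x * z + 1) powr \<alpha> / (- \<beta> * x + x + 1)))"
proof -
  define c where "c = conv_coeff \<alpha> \<beta> z"
  have coeff: "coeff_at \<alpha> \<beta> z = c"
    using coeff_at_eq_conv_coeff by (auto simp: c_def)
  define w where "w = (\<lambda>x::complex. x * (x + 1) powr (- \<beta>))"
  define S where "S = {x. ereal (norm (w x)) < conv_radius c \<and>
           (\<lambda>t. (t + 1) powr (- \<beta>)) analytic_on {x} \<and>
           (\<lambda>t. (t * z + 1) powr \<alpha>) analytic_on {x} \<and>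
           - \<beta> * x + x + 1 \<noteq> 0}"
  define V where "V = validity_region \<alpha> \<beta> z"
  have V: "V = connected_component_set S 0"
    by (simp add: V_def validity_region_def S_def coeff w_def)
  have w_analytic: "w analytic_on {x}" if "(\<lambda>t. (t + 1) powr (- \<beta>)) analytic_on {x}" for x
    unfolding w_def using that by (intro analytic_on_mult analytic_on_ident)
  \<comment> \<open>Openness of \<open>S\<close> passes to its component \<open>V\<close>, as the
    identity theorem requires. Each defining condition is stable under small changes of x;
    analyticity at a point already means holomorphy on a neighbourhood.\<close>
  have "open S"
  proof -
    have "\<forall>\<^sub>F y in nhds x. y \<in> S" if "x \<in> S" for x
    proof -
      have x: "ereal (norm (w x)) < conv_radius c" "(\<lambda>t. (t + 1) powr (- \<beta>)) analytic_on {x}"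
        "(\<lambda>t. (t * z + 1) powr \<alpha>) analytic_on {x}" "- \<beta> * x + x + 1 \<noteq> 0"
        using that by (auto simp: S_def)
      have "isCont w x" using w_analytic[OF x(2)] by (rule analytic_at_imp_isCont)
      then have "((\<lambda>y. ereal (norm (w y))) \<longlongrightarrow> ereal (norm (w x))) (nhds x)"
        by (intro tendsto_intros) (simp add: continuous_at tendsto_at_iff_tendsto_nhds)
      then have "\<forall>\<^sub>F y in nhds x. ereal (norm (w y)) < conv_radius c"
        using x(1) by (rule order_tendstoD(2))
      moreover have "\<forall>\<^sub>F y in nhds x. - \<beta> * y + y + 1 \<in> - {0}"
      proof (rule topological_tendstoD)
        show "((\<lambda>y. - \<beta> * y + y + 1) \<longlongrightarrow> - \<beta> * x + x + 1) (nhds x)"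
          by (intro tendsto_intros filterlim_ident)
      qed (use x(4) in auto)
      moreover have "\<forall>\<^sub>F y in nhds x. f analytic_on {y}" if f: "f analytic_on {x}" for f :: "complex \<Rightarrow> complex"
        using f unfolding analytic_at eventually_nhds by blast
      ultimately show ?thesis
        using x(2,3) unfolding S_def
        by (auto elim!: eventually_elim2 simp: eventually_conj_iff)
    qed
    then show ?thesis
      by (subst open_subopen) (simp add: eventually_nhds subset_eq)
  qed
  \<comment> \<open>Here w(0) = 0, so the norm condition at 0 is exactly positivity of the radius of
    convergence.\<close>
  have "0 \<in> S"
    using conv_radius_conv_coeff_pos[of \<alpha> \<beta> z]
    by (auto simp: S_def w_def c_def zero_ereal_def intro!: analytic_intros)
  then have "0 \<in> V" by (simp add: V)
  have "open V" using \<open>open S\<close> by (simp add: V open_connected_component)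
  have "V \<subseteq> S" by (simp add: V connected_component_subset)
  have small: "\<exists>r>0. ball 0 r \<subseteq> V" using \<open>open V\<close> \<open>0 \<in> V\<close> open_contains_ball by blast
  \<comment> \<open>The sum of the series as a power series composed with \<open>w\<close>. It is
    analytic on \<open>S\<close> because w(x) lies strictly inside the disc of convergence
    there.\<close>
  define f where "f = (\<lambda>x. eval_fps (Abs_fps c) (w x))"
  define g where "g = (\<lambda>x. (x + 1) * (x * z + 1) powr \<alpha> / (- \<beta> * x + x + 1))"
  have f_sums: "(\<lambda>n. c n * w x ^ n) sums f x" if "x \<in> S" for x
  proof -
    have "summable (\<lambda>n. c n * w x ^ n)"
      using that by (intro summable_in_conv_radius) (simp add: S_def)
    then show ?thesis by (simp add: f_def eval_fps_def summable_sums)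
  qed
  have f_hol: "f holomorphic_on V"
  proof -
    have "f analytic_on {x}" if "x \<in> S" for x
      unfolding f_def using that w_analytic
      by (intro analytic_intros) (auto simp: S_def fps_conv_radius_def)
    then show ?thesis
      using \<open>V \<subseteq> S\<close> by (meson analytic_imp_holomorphic analytic_on_analytic_at subsetD)
  qed
  have g_hol: "g holomorphic_on V"
  proof -
    have "g analytic_on {x}" if "x \<in> S" for x
      unfolding g_def using that
      by (intro analytic_on_mult analytic_on_add analytic_on_divide analytic_on_ident analytic_on_const)
         (auto simp: S_def)
    then show ?thesis
      using \<open>V \<subseteq> S\<close> by (meson analytic_imp_holomorphic analytic_on_analytic_at subsetD)
  qed
  obtain U where U: "open U" "0 \<in> U" "\<And>x. x \<in> U \<Longrightarrow> (\<lambda>n. c n * w x ^ n) sums g x"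
    using eventually_conv_coeff_sums[of \<alpha> \<beta> z] unfolding eventually_nhds c_def w_def g_def by blast
  \<comment> \<open>The local identity gives equality on the open set \<open>U \<inter> V\<close>,
    which contains 0, and connectedness of \<open>V\<close> spreads it to all of
    \<open>V\<close>.\<close>
  have "f x = g x" if "x \<in> V" for x
  proof (rule analytic_continuation_open[of "U \<inter> V" V f g])
    show "connected V" by (simp add: V)
    show "f y = g y" if "y \<in> U \<inter> V" for y
      using that U(3) f_sums \<open>V \<subseteq> S\<close> sums_unique2 by blast
  qed (use U \<open>open V\<close> \<open>0 \<in> V\<close> f_hol g_hol that in auto)
  then have "\<forall>x\<in>V. (\<lambda>n. c n * w x ^ n) sums g x"
    using f_sums \<open>V \<subseteq> S\<close> by (metis subsetD)
  with small show ?thesis unfolding V_def coeff w_def g_def by blast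
qed

end
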